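(* For any symmetric metric space $(X,d)$, the identity map $\mathrm{id}:X\to X$ uniquely extends to a continuous map between the FD-completion $(\overline X,\bar d)$ of $(X,d)$ and its Cauchy completion. Moreover, this extension map is an isometric homeomorphism between $(\overline X,\bar d)$ and the Cauchy completion.
   Context: For an asymmetric metric space $(X,d)$ (a function $d:X\times X\to[0,\infty]$ with $d(x,x)=0$; $d(x,y)=d(y,x)=0\Rightarrow x=y$; and $d(x,z)\le d(x,y)+d(y,z)$), a forward FD-sequence is a sequence $(x_n)$ with $\sum_{i=1}^\infty d(x_i,x_{i+1})<\infty$. An interlacing of $(x_i)$ and $(x'_j)$ is a sequence composed of terms of the two sequences such that the subsequence of terms from $(x_i)$ is infinite with strictly increasing indices, and likewise for the terms from $(x'_j)$. Two forward FD-sequences are forward FD-equivalent if they have an interlacing which is a forward FD-sequence; this is an equivalence relation. The forward FD-completion $\overline X$ is the set of equivalence classes, equipped with the asymmetric metric $\bar d([x_n],[y_m])=\inf\liminf_{k\to\infty}d(x'_k,y'_k)$, the infimum over all forward FD-sequences $(x'_n)\in[x_n]$ and $(y'_m)\in[y_m]$. $X$ is regarded as a subset of $\overline X$ via $x\mapsto$ the class of the constant sequence $(x)$, and as a subset of its Cauchy completion in the usual way. When $d$ is symmetric ($d(x,y)=d(y,x)$), the forward notions agree with the analogous backward ones (using $\sum_i d(x_{i+1},x_i)$), so one speaks simply of the FD-completion. *)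

theory Defs
  imports "HOL-Analysis.Analysis"
begin

definition asym_metric_on :: "'a set \<Rightarrow> ('a \<Rightarrow> 'a \<Rightarrow> ennreal) \<Rightarrow> bool" where
  "asym_metric_on X d \<longleftrightarrow>
     (\<forall>x\<in>X. d x x = 0) \<and>
     (\<forall>x\<in>X. \<forall>y\<in>X. d x y = 0 \<and> d y x = 0 \<longrightarrow> x = y) \<and>
     (\<forall>x\<in>X. \<forall>y\<in>X. \<forall>z\<in>X. d x z \<le> d x y + d y z)"

definition sym_metric_on :: "'a set \<Rightarrow> ('a \<Rightarrow> 'a \<Rightarrow> ennreal) \<Rightarrow> bool" where
  "sym_metric_on X d \<longleftrightarrow> asym_metric_on X d \<and> (\<forall>x\<in>X. \<forall>y\<in>X. d x y = d y x)"

text \<open>The topology of the balls \<open>{y \<in> M. d x y < r}\<close>. For a distance that is not symmetric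
  this is one of two possible choices; below it is only used for symmetric distances.\<close>

definition dist_topology :: "'a set \<Rightarrow> ('a \<Rightarrow> 'a \<Rightarrow> ennreal) \<Rightarrow> 'a topology" where
  "dist_topology M d =
     topology (\<lambda>U. U \<subseteq> M \<and> (\<forall>x\<in>U. \<exists>r>0. {y\<in>M. d x y < r} \<subseteq> U))"

lemma openin_dist_topology:
  "openin (dist_topology M d) U \<longleftrightarrow> U \<subseteq> M \<and> (\<forall>x\<in>U. \<exists>r>0. {y\<in>M. d x y < r} \<subseteq> U)"
proof -
  let ?P = "\<lambda>U. U \<subseteq> M \<and> (\<forall>x\<in>U. \<exists>r>0. {y\<in>M. d x y < r} \<subseteq> U)"
  have inter: "?P (S \<inter> T)" if S: "?P S" and T: "?P T" for S T
  proof (intro conjI ballI)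
    fix x assume x: "x \<in> S \<inter> T"
    from S x obtain r where r: "r > 0" "{y\<in>M. d x y < r} \<subseteq> S" by blast
    from T x obtain s where s: "s > 0" "{y\<in>M. d x y < s} \<subseteq> T" by blast
    have "{y\<in>M. d x y < min r s} \<subseteq> S \<inter> T"
      using r(2) s(2) by auto
    then show "\<exists>r>0. {y\<in>M. d x y < r} \<subseteq> S \<inter> T"
      using r(1) s(1) by (intro exI[of _ "min r s"]) simp
  qed (use S in blast)
  have union: "?P (\<Union>\<K>)" if K: "\<And>K. K \<in> \<K> \<Longrightarrow> ?P K" for \<K>
  proof (intro conjI ballI)
    show "\<Union>\<K> \<subseteq> M" using K by (simp add: Sup_least)
  next
    fix x assume "x \<in> \<Union>\<K>"
    then obtain K where "K \<in> \<K>" "x \<in> K" by (rule UnionE)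
    moreover from K[OF this(1)] this(2) obtain r where "r > 0" "{y\<in>M. d x y < r} \<subseteq> K"
      by blast
    ultimately show "\<exists>r>0. {y\<in>M. d x y < r} \<subseteq> \<Union>\<K>" by blast
  qed
  have "istopology ?P"
    unfolding istopology_def
  proof (rule conjI; intro allI impI)
    fix S T assume "?P S" "?P T"
    then show "?P (S \<inter> T)" by (rule inter)
  next
    fix \<K> assume "\<forall>K\<in>\<K>. ?P K"
    then show "?P (\<Union>\<K>)" by (intro union) (erule (1) bspec)
  qed
  then show ?thesis
    unfolding dist_topology_def by (simp only: topology_inverse')
qed

lemma topspace_dist_topology [simp]: "topspace (dist_topology M d) = M"
proof (rule subset_antisym)
  show "topspace (dist_topology M d) \<subseteq> M"
    using openin_dist_topology[THEN iffD1, OF openin_topspace] by (rule conjunct1)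
  have "openin (dist_topology M d) M"
    unfolding openin_dist_topology by (auto intro: exI[of _ 1])
  then show "M \<subseteq> topspace (dist_topology M d)"
    by (rule openin_subset)
qed

definition fd_seq :: "'a set \<Rightarrow> ('a \<Rightarrow> 'a \<Rightarrow> ennreal) \<Rightarrow> (nat \<Rightarrow> 'a) \<Rightarrow> bool" where
  "fd_seq X d x \<longleftrightarrow> range x \<subseteq> X \<and> (\<Sum>i. d (x i) (x (Suc i))) < \<infinity>"

text \<open>\<open>A\<close> is the set of positions of \<open>z\<close> filled with terms of \<open>x\<close>, and \<open>\<phi> n\<close> is the index,
  in the sequence it comes from, of the term at position \<open>n\<close>. Terms of \<open>x\<close> and \<open>y\<close> may be
  skipped.\<close>

definition interlacing :: "(nat \<Rightarrow> 'a) \<Rightarrow> (nat \<Rightarrow> 'a) \<Rightarrow> (nat \<Rightarrow> 'a) \<Rightarrow> bool" where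
  "interlacing x y z \<longleftrightarrow>
     (\<exists>A \<phi>. infinite A \<and> infinite (- A) \<and>
        strict_mono_on A \<phi> \<and> strict_mono_on (- A) \<phi> \<and>
        (\<forall>n\<in>A. z n = x (\<phi> n)) \<and> (\<forall>n\<in>- A. z n = y (\<phi> n)))"

definition fd_rel :: "'a set \<Rightarrow> ('a \<Rightarrow> 'a \<Rightarrow> ennreal) \<Rightarrow> (nat \<Rightarrow> 'a) rel" where
  "fd_rel X d = {(x, y). fd_seq X d x \<and> fd_seq X d y \<and> (\<exists>z. interlacing x y z \<and> fd_seq X d z)}"

definition fd_completion :: "'a set \<Rightarrow> ('a \<Rightarrow> 'a \<Rightarrow> ennreal) \<Rightarrow> (nat \<Rightarrow> 'a) set set" where
  "fd_completion X d = {x. fd_seq X d x} // fd_rel X d"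

definition fd_dist ::
  "('a \<Rightarrow> 'a \<Rightarrow> ennreal) \<Rightarrow> (nat \<Rightarrow> 'a) set \<Rightarrow> (nat \<Rightarrow> 'a) set \<Rightarrow> ennreal" where
  "fd_dist d \<xi> \<eta> = (INF x\<in>\<xi>. INF y\<in>\<eta>. liminf (\<lambda>k. d (x k) (y k)))"

definition fd_embed :: "'a set \<Rightarrow> ('a \<Rightarrow> 'a \<Rightarrow> ennreal) \<Rightarrow> 'a \<Rightarrow> (nat \<Rightarrow> 'a) set" where
  "fd_embed X d a = fd_rel X d `` {\<lambda>_. a}"

text \<open>The usual completion by classes of Cauchy sequences, spelled out here because the
  distance may take the value \<open>\<infinity>\<close>.\<close>

definition cauchy_seq :: "'a set \<Rightarrow> ('a \<Rightarrow> 'a \<Rightarrow> ennreal) \<Rightarrow> (nat \<Rightarrow> 'a) \<Rightarrow> bool" where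
  "cauchy_seq X d x \<longleftrightarrow>
     range x \<subseteq> X \<and> (\<forall>e>0. \<exists>N. \<forall>m\<ge>N. \<forall>n\<ge>N. d (x m) (x n) < e)"

definition cauchy_rel :: "'a set \<Rightarrow> ('a \<Rightarrow> 'a \<Rightarrow> ennreal) \<Rightarrow> (nat \<Rightarrow> 'a) rel" where
  "cauchy_rel X d =
     {(x, y). cauchy_seq X d x \<and> cauchy_seq X d y \<and> (\<lambda>n. d (x n) (y n)) \<longlonglongrightarrow> 0}"

definition cauchy_completion :: "'a set \<Rightarrow> ('a \<Rightarrow> 'a \<Rightarrow> ennreal) \<Rightarrow> (nat \<Rightarrow> 'a) set set" where
  "cauchy_completion X d = {x. cauchy_seq X d x} // cauchy_rel X d"

definition cauchy_dist ::
  "('a \<Rightarrow> 'a \<Rightarrow> ennreal) \<Rightarrow> (nat \<Rightarrow> 'a) set \<Rightarrow> (nat \<Rightarrow> 'a) set \<Rightarrow> ennreal" where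
  "cauchy_dist d \<xi> \<eta> = (THE r. \<forall>x\<in>\<xi>. \<forall>y\<in>\<eta>. (\<lambda>n. d (x n) (y n)) \<longlonglongrightarrow> r)"

definition cauchy_embed :: "'a set \<Rightarrow> ('a \<Rightarrow> 'a \<Rightarrow> ennreal) \<Rightarrow> 'a \<Rightarrow> (nat \<Rightarrow> 'a) set" where
  "cauchy_embed X d a = cauchy_rel X d `` {\<lambda>_. a}"

abbreviation fd_topology :: "'a set \<Rightarrow> ('a \<Rightarrow> 'a \<Rightarrow> ennreal) \<Rightarrow> (nat \<Rightarrow> 'a) set topology" where
  "fd_topology X d \<equiv> dist_topology (fd_completion X d) (fd_dist d)"

abbreviation cauchy_topology :: "'a set \<Rightarrow> ('a \<Rightarrow> 'a \<Rightarrow> ennreal) \<Rightarrow> (nat \<Rightarrow> 'a) set topology" where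
  "cauchy_topology X d \<equiv> dist_topology (cauchy_completion X d) (cauchy_dist d)"

definition continuous_id_extension ::
  "'a set \<Rightarrow> ('a \<Rightarrow> 'a \<Rightarrow> ennreal) \<Rightarrow> ((nat \<Rightarrow> 'a) set \<Rightarrow> (nat \<Rightarrow> 'a) set) \<Rightarrow> bool" where
  "continuous_id_extension X d f \<longleftrightarrow>
     continuous_map (fd_topology X d) (cauchy_topology X d) f \<and>
     (\<forall>a\<in>X. f (fd_embed X d a) = cauchy_embed X d a)"

end

theory Submission
  imports Defs
begin

text \<open>An FD-sequence is a Cauchy sequence, every Cauchy sequence has an FD-subsequence, and two
  FD-sequences are FD-equivalent iff they are equivalent as Cauchy sequences. Hence sending
  an FD-class to the Cauchy class containing it is a bijection. For Cauchy sequences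
  \<open>d (x k) (y k)\<close> converges in \<open>[0,\<infinity>]\<close> to a value depending only on the classes, so the
  infimum of lower limits that defines the FD-distance is taken over a single value, the Cauchy
  distance. Uniqueness holds because the constant sequences are dense.\<close>

section \<open>Distances with values in the extended nonnegative reals\<close>

text \<open>Thirds are taken of a finite \<open>u\<close> strictly between 0 and \<open>e\<close>,
  because \<open>e\<close> itself may be \<infinity>. Estimates with two summands use it with 0 as
  the third one.\<close>

lemma ennreal_third:
  fixes e :: ennreal
  assumes "e > 0"
  obtains h where "h > 0" "\<And>a b c. a < h \<Longrightarrow> b < h \<Longrightarrow> c < h \<Longrightarrow> a + b + c < e"
proof -
  obtain u where u: "0 < u" "u < e" using dense[OF assms] by blast
  then have "u < \<infinity>" by (metis infinity_ennreal_def less_top order_less_le_trans top_greatest)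
  then obtain r where r: "u = ennreal r" "0 \<le> r"
    by (cases u) auto
  with u have r0: "0 < r" by simp
  show ?thesis
  proof (rule that[of "ennreal (r / 3)"])
    show "0 < ennreal (r / 3)" using r0 by simp
    fix a b c assume h: "a < ennreal (r / 3)" "b < ennreal (r / 3)" "c < ennreal (r / 3)"
    have "a + b + c < ennreal (r / 3 + r / 3 + r / 3)"
      by (intro add_mono_ennreal h)
    also have "\<dots> = u" using r by simp
    finally show "a + b + c < e" using u by (meson order_less_trans)
  qed
qed

lemma tendsto_0_ennreal_iff:
  fixes f :: "nat \<Rightarrow> ennreal"
  shows "f \<longlonglongrightarrow> 0 \<longleftrightarrow> (\<forall>e>0. \<exists>N. \<forall>n\<ge>N. f n < e)"
  by (simp add: order_tendsto_iff eventually_sequentially)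

text \<open>Since \<open>\<phi>\<close> is injective on \<open>A\<close>, only finitely many points
  of \<open>A\<close> have a value below \<open>N\<close>, and only finitely many lie below
  \<open>N\<close> themselves. For an interlacing this gives terms that come late both in it and in
  their source.\<close>

lemma strict_mono_on_infinite_large:
  fixes A :: "nat set" and \<phi> :: "nat \<Rightarrow> nat"
  assumes "infinite A" "strict_mono_on A \<phi>"
  obtains p where "p \<in> A" "p \<ge> N" "\<phi> p \<ge> N"
proof -
  have "finite (\<phi> -` {..<N} \<inter> A)"
    using finite_vimage_IntI[OF _ strict_mono_on_imp_inj_on[OF assms(2)]] by blast
  then have "finite ((\<phi> -` {..<N} \<inter> A) \<union> {..<N})" by simp
  then obtain p where "p \<in> A" "p \<notin> (\<phi> -` {..<N} \<inter> A) \<union> {..<N}"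
    using assms(1) by (meson finite_subset subsetI)
  then show ?thesis using that[of p] by auto
qed

lemma sym_metric_onD:
  assumes "sym_metric_on X d"
  shows sym_metric_on_refl: "x \<in> X \<Longrightarrow> d x x = 0"
    and sym_metric_on_sym: "x \<in> X \<Longrightarrow> y \<in> X \<Longrightarrow> d x y = d y x"
    and sym_metric_on_eq: "x \<in> X \<Longrightarrow> y \<in> X \<Longrightarrow> d x y = 0 \<Longrightarrow> x = y"
    and sym_metric_on_triangle: "x \<in> X \<Longrightarrow> y \<in> X \<Longrightarrow> z \<in> X \<Longrightarrow> d x z \<le> d x y + d y z"
  using assms unfolding sym_metric_on_def asym_metric_on_def by auto

section \<open>Balls and isometries in the topology of a distance\<close>

lemma openin_dist_ball:
  assumes "sym_metric_on M d" "x \<in> M"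
  shows "openin (dist_topology M d) {y\<in>M. d x y < r}"
  unfolding openin_dist_topology
proof (intro conjI ballI)
  fix y assume y: "y \<in> {y\<in>M. d x y < r}"
  then have "0 < r - d x y" by (simp add: diff_gr0_ennreal less_top_ennreal)
  moreover have "d x z < r" if z: "z \<in> M" "d y z < r - d x y" for z
  proof -
    have "d x z \<le> d x y + d y z"
      using sym_metric_on_triangle[OF assms(1)] assms(2) y z by blast
    \<comment> \<open>Moving \<open>d x y\<close> to the other side of the inequality requires it to
      be finite, which follows from \<open>d x y < r\<close>.\<close>
    also have "\<dots> < r"
      using z(2) y less_diff_eq_ennreal[of r "d x y" "d y z"]
      by (auto simp: add.commute dest: order_less_le_trans[OF _ top_greatest])
    finally show ?thesis .
  qed
  ultimately show "\<exists>s>0. {z\<in>M. d y z < s} \<subseteq> {y\<in>M. d x y < r}" by blast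
qed auto

lemma continuous_map_isometry:
  assumes "f ` M \<subseteq> M'" "\<And>x y. x \<in> M \<Longrightarrow> y \<in> M \<Longrightarrow> d' (f x) (f y) = d x y"
  shows "continuous_map (dist_topology M d) (dist_topology M' d') f"
  unfolding continuous_map_def
proof (intro conjI allI impI)
  show "f \<in> topspace (dist_topology M d) \<rightarrow> topspace (dist_topology M' d')"
    using assms(1) by auto
  fix U assume U: "openin (dist_topology M' d') U"
  show "openin (dist_topology M d) {x \<in> topspace (dist_topology M d). f x \<in> U}"
    unfolding openin_dist_topology topspace_dist_topology
  proof (intro conjI ballI)
    fix x assume x: "x \<in> {x \<in> M. f x \<in> U}"
    then obtain r where "r > 0" "{y\<in>M'. d' (f x) y < r} \<subseteq> U"
      using U unfolding openin_dist_topology by blast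
    then show "\<exists>r>0. {y\<in>M. d x y < r} \<subseteq> {x \<in> M. f x \<in> U}"
      using assms x by (intro exI[of _ r]) (auto 4 4)
  qed auto
qed

text \<open>The inverse of a distance-preserving bijection preserves distances too, so
  \<open>continuous_map_isometry\<close> applies in both directions.\<close>

lemma homeomorphic_map_isometry:
  assumes bij: "bij_betw f M M'"
    and iso: "\<And>x y. x \<in> M \<Longrightarrow> y \<in> M \<Longrightarrow> d' (f x) (f y) = d x y"
  shows "homeomorphic_map (dist_topology M d) (dist_topology M' d') f"
proof -
  let ?g = "inv_into M f"
  have fg: "f (?g y) = y" "?g y \<in> M" if "y \<in> M'" for y
    using that bij by (auto simp: bij_betw_def f_inv_into_f inv_into_into)
  have "continuous_map (dist_topology M d) (dist_topology M' d') f"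
    using bij iso by (intro continuous_map_isometry) (auto simp: bij_betw_def)
  moreover have "continuous_map (dist_topology M' d') (dist_topology M d) ?g"
    using fg by (intro continuous_map_isometry) (auto simp flip: iso)
  ultimately have "homeomorphic_maps (dist_topology M d) (dist_topology M' d') f ?g"
    using bij fg by (auto simp: homeomorphic_maps_def bij_betw_def)
  then show ?thesis
    by (auto simp: homeomorphic_map_maps)
qed

section \<open>Classes of Cauchy sequences and of FD-sequences\<close>

context
  fixes X :: "'a set" and d :: "'a \<Rightarrow> 'a \<Rightarrow> ennreal"
  assumes sm: "sym_metric_on X d"
begin

lemma triangle3:
  assumes "a \<in> X" "b \<in> X" "p \<in> X" "q \<in> X"
  shows "d a b \<le> d a p + d p q + d q b"
  using assms
  by (intro order_trans[OF sym_metric_on_triangle[OF sm, of a q b] add_right_mono]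
      sym_metric_on_triangle[OF sm])

lemma cauchy_seq_in: "cauchy_seq X d x \<Longrightarrow> x n \<in> X"
  by (auto simp: cauchy_seq_def)

lemma fd_seq_in: "fd_seq X d x \<Longrightarrow> x n \<in> X"
  by (auto simp: fd_seq_def)

lemma cauchy_seqD:
  assumes "cauchy_seq X d x" "e > 0"
  obtains N where "\<And>m n. m \<ge> N \<Longrightarrow> n \<ge> N \<Longrightarrow> d (x m) (x n) < e"
proof -
  have "\<forall>e>0. \<exists>N. \<forall>m\<ge>N. \<forall>n\<ge>N. d (x m) (x n) < e"
    using assms(1) by (simp add: cauchy_seq_def)
  with assms(2) obtain N where "\<forall>m\<ge>N. \<forall>n\<ge>N. d (x m) (x n) < e" by metis
  then show ?thesis by (intro that[of N]) simp
qed

lemma equiv_cauchy_rel: "equiv {x. cauchy_seq X d x} (cauchy_rel X d)"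
proof (rule equivI)
  show "cauchy_rel X d \<subseteq> {x. cauchy_seq X d x} \<times> {x. cauchy_seq X d x}"
    by (auto simp: cauchy_rel_def)
  show "refl_on {x. cauchy_seq X d x} (cauchy_rel X d)"
    by (auto simp: refl_on_def cauchy_rel_def sym_metric_on_refl[OF sm] cauchy_seq_in)
  show "sym (cauchy_rel X d)"
    using sym_metric_on_sym[OF sm] by (auto simp: sym_def cauchy_rel_def cauchy_seq_in)
  show "trans (cauchy_rel X d)"
  proof (rule transI)
    fix x y z assume "(x, y) \<in> cauchy_rel X d" "(y, z) \<in> cauchy_rel X d"
    then have c: "cauchy_seq X d x" "cauchy_seq X d y" "cauchy_seq X d z"
      and l: "(\<lambda>n. d (x n) (y n)) \<longlonglongrightarrow> 0" "(\<lambda>n. d (y n) (z n)) \<longlonglongrightarrow> 0"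
      by (auto simp: cauchy_rel_def)
    have "(\<lambda>n. d (x n) (y n) + d (y n) (z n)) \<longlonglongrightarrow> 0"
      using tendsto_add[OF l] by simp
    then have "(\<lambda>n. d (x n) (z n)) \<longlonglongrightarrow> 0"
      by (rule tendsto_sandwich[OF _ _ tendsto_const, rotated 2])
        (auto intro!: always_eventually sym_metric_on_triangle[OF sm] c[THEN cauchy_seq_in])
    then show "(x, z) \<in> cauchy_rel X d" using c by (simp add: cauchy_rel_def)
  qed
qed

section \<open>FD-sequences compared with Cauchy sequences\<close>

text \<open>By the triangle inequality \<open>d (x m) (x n)\<close> is at most a block of the
  convergent series of consecutive distances, and such blocks become small by the Cauchy criterion
  for real series.\<close>

lemma fd_seq_imp_cauchy_seq:
  assumes "fd_seq X d x"
  shows "cauchy_seq X d x"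
proof -
  \<comment> \<open>A finite sum has finite terms, so passing to real numbers loses nothing.\<close>
  define s where "s i = enn2real (d (x i) (x (Suc i)))" for i
  have fin: "(\<Sum>i. d (x i) (x (Suc i))) \<noteq> top"
    using assms by (auto simp: fd_seq_def)
  have ds: "d (x i) (x (Suc i)) = ennreal (s i)" for i
    using ennreal_suminf_lessD[of "\<lambda>i. d (x i) (x (Suc i))" top i] fin
    by (simp add: s_def less_top)
  have s0: "0 \<le> s i" for i by (simp add: s_def)
  have "summable s"
    using fin unfolding ds by (intro summable_suminf_not_top s0)
  have le: "d (x m) (x n) \<le> ennreal (sum s {m..<n})" if "m \<le> n" for m n
    using that
  proof (induction n rule: dec_induct)
    case base
    then show ?case using sym_metric_on_refl[OF sm] assms by (simp add: fd_seq_in)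
  next
    case (step n)
    have "d (x m) (x (Suc n)) \<le> d (x m) (x n) + d (x n) (x (Suc n))"
      by (intro sym_metric_on_triangle[OF sm] fd_seq_in assms)
    also have "\<dots> \<le> ennreal (sum s {m..<n}) + ennreal (s n)"
      using step.IH by (simp add: ds add_right_mono)
    also have "\<dots> = ennreal (sum s {m..<Suc n})"
      using step.hyps s0 by (simp add: sum_nonneg)
    finally show ?case .
  qed
  have "\<exists>N. \<forall>m\<ge>N. \<forall>n\<ge>N. d (x m) (x n) < e" if e: "e > 0" for e
  proof -
    obtain u where u: "0 < u" "u < e" using dense[OF e] by blast
    then have "u < \<infinity>" by (metis infinity_ennreal_def less_top order_less_le_trans top_greatest)
    then obtain r where r: "u = ennreal r" "0 \<le> r" by (cases u) auto
    with u have "0 < r" by simp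
    with \<open>summable s\<close> obtain N where N: "\<And>m n. m \<ge> N \<Longrightarrow> norm (sum s {m..<n}) < r"
      unfolding summable_Cauchy by blast
    have less: "d (x m) (x n) < e" if "N \<le> m" "m \<le> n" for m n
    proof -
      have "d (x m) (x n) \<le> ennreal (sum s {m..<n})" using le that by simp
      also have "\<dots> \<le> u" using N[OF that(1), of n] r by (auto intro!: ennreal_leI)
      finally show ?thesis using u by (meson order_le_less_trans)
    qed
    \<comment> \<open>Sums of forward steps bound distances only for \<open>m \<le> n\<close>;
      symmetry gives the other order.\<close>
    have "d (x m) (x n) < e" if "N \<le> m" "N \<le> n" for m n
      using less[of m n] less[of n m] that sym_metric_on_sym[OF sm, of "x m" "x n"]
        fd_seq_in[OF assms] by (cases "m \<le> n") auto
    then show ?thesis by blast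
  qed
  moreover have "range x \<subseteq> X" using assms by (simp add: fd_seq_def)
  ultimately show ?thesis by (simp add: cauchy_seq_def)
qed

text \<open>As \<open>r n \<ge> n\<close>, the indices \<open>n\<close> and \<open>r n\<close> pass
  any Cauchy threshold of \<open>x\<close> together. The FD hypothesis supplies that
  \<open>x \<circ> r\<close> is itself Cauchy.\<close>

lemma cauchy_rel_subseq:
  assumes "cauchy_seq X d x" "strict_mono r" "fd_seq X d (x \<circ> r)"
  shows "(x, x \<circ> r) \<in> cauchy_rel X d"
proof -
  have "\<exists>N. \<forall>n\<ge>N. d (x n) (x (r n)) < e" if e: "e > 0" for e
  proof -
    obtain N where "\<And>m n. m \<ge> N \<Longrightarrow> n \<ge> N \<Longrightarrow> d (x m) (x n) < e"
      using cauchy_seqD[OF assms(1) e] by blast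
    then show ?thesis
      using strict_mono_imp_increasing[OF assms(2)] by (meson order_trans)
  qed
  then show ?thesis
    using assms fd_seq_imp_cauchy_seq by (simp add: cauchy_rel_def tendsto_0_ennreal_iff)
qed

text \<open>Indices are chosen so sparsely that the alternating sequence has geometrically
  decreasing steps. For \<open>y = x\<close> this yields an FD-subsequence of a Cauchy sequence; for
  equivalent FD-sequences it yields the interlacing that makes them FD-equivalent.\<close>

lemma cauchy_rel_fd_interlacing:
  assumes "(x, y) \<in> cauchy_rel X d"
  obtains r :: "nat \<Rightarrow> nat"
  where "strict_mono r" "fd_seq X d (\<lambda>n. if even n then x (r n) else y (r n))"
proof -
  have c: "cauchy_seq X d x" "cauchy_seq X d y" and l: "(\<lambda>n. d (x n) (y n)) \<longlonglongrightarrow> 0"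
    using assms by (auto simp: cauchy_rel_def)
  note in_X = c[THEN cauchy_seq_in]
  define e where "e n = (1 / 2 :: real) ^ n" for n :: nat
  have "\<exists>N. \<forall>m\<ge>N. (\<forall>n\<ge>N. d (x m) (x n) < ennreal (e k)) \<and> d (x m) (y m) < ennreal (e k)" for k
  proof -
    have e0: "ennreal (e k) > 0" by (simp add: e_def)
    obtain N1 where N1: "\<And>m n. m \<ge> N1 \<Longrightarrow> n \<ge> N1 \<Longrightarrow> d (x m) (x n) < ennreal (e k)"
      using cauchy_seqD[OF c(1) e0] by blast
    obtain N2 where "\<And>n. n \<ge> N2 \<Longrightarrow> d (x n) (y n) < ennreal (e k)"
      using l e0 unfolding tendsto_0_ennreal_iff by blast
    then show ?thesis using N1 by (intro exI[of _ "max N1 N2"]) auto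
  qed
  then obtain N where
    N: "\<And>k m n. m \<ge> N k \<Longrightarrow> n \<ge> N k \<Longrightarrow> d (x m) (x n) < ennreal (e k)"
       "\<And>k m. m \<ge> N k \<Longrightarrow> d (x m) (y m) < ennreal (e k)"
    by metis
  \<comment> \<open>The sum puts \<open>r n\<close> beyond the threshold \<open>N n\<close>, and the
    summand \<open>n\<close> makes \<open>r\<close> strictly increasing.\<close>
  define r where "r n = n + (\<Sum>i\<le>n. N i)" for n
  have r: "strict_mono r" by (simp add: strict_mono_Suc_iff r_def)
  have rN: "r n \<ge> N n" "r (Suc n) \<ge> N n" for n
  proof -
    show "r n \<ge> N n" by (simp add: r_def member_le_sum trans_le_add2)
    then show "r (Suc n) \<ge> N n" using r by (meson lessI less_imp_le order_trans strict_monoD)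
  qed
  define z where "z n = (if even n then x (r n) else y (r n))" for n
  \<comment> \<open>Both cases detour through \<open>x\<close>: from an even position along
    \<open>x\<close> and then across to \<open>y\<close>, from an odd position across to
    \<open>x\<close> and then along it. Each leg is shorter than \<open>e n\<close>.\<close>
  have step: "d (z n) (z (Suc n)) \<le> ennreal (2 * e n)" for n
  proof (cases "even n")
    case True
    then have "d (z n) (z (Suc n)) \<le> d (x (r n)) (x (r (Suc n))) + d (x (r (Suc n))) (y (r (Suc n)))"
      using sym_metric_on_triangle[OF sm] in_X by (simp add: z_def)
    also have "\<dots> \<le> ennreal (e n) + ennreal (e n)"
      by (intro add_mono less_imp_le N rN)
    finally show ?thesis by (simp add: e_def flip: ennreal_plus)
  next
    case False
    then have "d (z n) (z (Suc n)) \<le> d (y (r n)) (x (r n)) + d (x (r n)) (x (r (Suc n)))"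
      using sym_metric_on_triangle[OF sm] in_X by (simp add: z_def)
    also have "d (y (r n)) (x (r n)) = d (x (r n)) (y (r n))"
      using sym_metric_on_sym[OF sm] in_X by simp
    also have "d (x (r n)) (y (r n)) + d (x (r n)) (x (r (Suc n))) \<le> ennreal (e n) + ennreal (e n)"
      by (intro add_mono less_imp_le N rN)
    finally show ?thesis by (simp add: e_def flip: ennreal_plus)
  qed
  have "(\<Sum>n. d (z n) (z (Suc n))) \<le> (\<Sum>n. ennreal (2 * e n))"
    by (intro suminf_le step summableI)
  also have "\<dots> = ennreal (\<Sum>n. 2 * e n)"
    by (intro suminf_ennreal2) (auto simp: e_def intro!: summable_mult summable_geometric)
  also have "\<dots> < \<infinity>" by simp
  finally have "fd_seq X d z"
    using in_X by (auto simp: fd_seq_def z_def)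
  then show ?thesis using that[OF r] unfolding z_def by blast
qed

text \<open>Alternating \<open>x\<close> with itself gives a subsequence of \<open>x\<close>. This
  is what makes the map between the completions surjective.\<close>

lemma cauchy_rel_fd_seq:
  assumes "cauchy_seq X d x"
  obtains y where "fd_seq X d y" "(x, y) \<in> cauchy_rel X d"
proof -
  have "(x, x) \<in> cauchy_rel X d"
    using assms equiv_cauchy_rel by (auto simp: equiv_def refl_on_def)
  then obtain r where "strict_mono r" "fd_seq X d (x \<circ> r)"
    by (rule cauchy_rel_fd_interlacing) (simp add: comp_def)
  then show ?thesis using that cauchy_rel_subseq[OF assms] by blast
qed

text \<open>An interlacing that is an FD-sequence is Cauchy and has arbitrarily late terms from both
  sequences, which forces them together. The converse is the alternating construction. Hence
  FD-equivalence is Cauchy equivalence restricted to FD-sequences.\<close>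

lemma fd_rel_iff_cauchy_rel:
  "(x, y) \<in> fd_rel X d \<longleftrightarrow> fd_seq X d x \<and> fd_seq X d y \<and> (x, y) \<in> cauchy_rel X d"
proof (intro iffI)
  assume "(x, y) \<in> fd_rel X d"
  then obtain z where fd: "fd_seq X d x" "fd_seq X d y" "fd_seq X d z" and "interlacing x y z"
    unfolding fd_rel_def by blast
  then obtain A \<phi> where A: "infinite A" "infinite (- A)" "strict_mono_on A \<phi>" "strict_mono_on (- A) \<phi>"
    and z: "\<And>n. n \<in> A \<Longrightarrow> z n = x (\<phi> n)" "\<And>n. n \<in> - A \<Longrightarrow> z n = y (\<phi> n)"
    unfolding interlacing_def by metis
  note c = fd[THEN fd_seq_imp_cauchy_seq]
  note in_X = fd[THEN fd_seq_in]
  have "\<exists>N. \<forall>n\<ge>N. d (x n) (y n) < e" if "e > 0" for e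
  proof -
    obtain h where h: "h > 0" "\<And>a b c. a < h \<Longrightarrow> b < h \<Longrightarrow> c < h \<Longrightarrow> a + b + c < e"
      using ennreal_third[OF \<open>e > 0\<close>] by metis
    obtain N1 where N1: "\<And>m n. m \<ge> N1 \<Longrightarrow> n \<ge> N1 \<Longrightarrow> d (x m) (x n) < h"
      using cauchy_seqD[OF c(1) h(1)] by blast
    obtain N2 where N2: "\<And>m n. m \<ge> N2 \<Longrightarrow> n \<ge> N2 \<Longrightarrow> d (y m) (y n) < h"
      using cauchy_seqD[OF c(2) h(1)] by blast
    obtain N3 where N3: "\<And>m n. m \<ge> N3 \<Longrightarrow> n \<ge> N3 \<Longrightarrow> d (z m) (z n) < h"
      using cauchy_seqD[OF c(3) h(1)] by blast
    define N where "N = max N1 (max N2 N3)"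
    \<comment> \<open>The positions \<open>p\<close> and \<open>q\<close> are late in
      \<open>z\<close>, and the terms there are late in \<open>x\<close> and \<open>y\<close>
      respectively, so all three Cauchy thresholds apply.\<close>
    obtain p where p: "p \<in> A" "p \<ge> N" "\<phi> p \<ge> N"
      using strict_mono_on_infinite_large[OF A(1,3)] .
    obtain q where q: "q \<in> - A" "q \<ge> N" "\<phi> q \<ge> N"
      using strict_mono_on_infinite_large[OF A(2,4)] .
    have "d (x n) (y n) < e" if "n \<ge> N" for n
    proof -
      \<comment> \<open>The outer distances lie within \<open>x\<close> and within \<open>y\<close>,
        because \<open>z p = x (\<phi> p)\<close> and \<open>z q = y (\<phi> q)\<close>; the middle
        one lies within \<open>z\<close>.\<close>
      have "d (x n) (y n) \<le> d (x n) (z p) + d (z p) (z q) + d (z q) (y n)"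
        by (intro triangle3 in_X)
      also have "\<dots> < e"
        using p q that by (intro h(2) N3) (auto simp: z N_def intro!: N1 N2)
      finally show ?thesis .
    qed
    then show ?thesis by blast
  qed
  then show "fd_seq X d x \<and> fd_seq X d y \<and> (x, y) \<in> cauchy_rel X d"
    using fd c by (simp add: cauchy_rel_def tendsto_0_ennreal_iff)
next
  assume R: "fd_seq X d x \<and> fd_seq X d y \<and> (x, y) \<in> cauchy_rel X d"
  then obtain r where r: "strict_mono r" "fd_seq X d (\<lambda>n. if even n then x (r n) else y (r n))"
    using cauchy_rel_fd_interlacing by blast
  have "\<exists>n\<ge>m. n \<in> {n. even n}" "\<exists>n\<ge>m. n \<in> - {n. even n}" for m :: nat
    by (rule exI[of _ "2 * m"], simp) (rule exI[of _ "2 * m + 1"], simp)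
  then have inf: "infinite {n :: nat. even n}" "infinite (- {n :: nat. even n})"
    unfolding infinite_nat_iff_unbounded_le by blast+
  \<comment> \<open>The even positions carry terms of \<open>x\<close>, and the single index
    function \<open>r\<close> serves both sequences.\<close>
  have "interlacing x y (\<lambda>n. if even n then x (r n) else y (r n))"
    unfolding interlacing_def
    using inf r(1) by (intro exI[of _ "{n. even n}"] exI[of _ r]) (auto simp: strict_mono_on_def strict_mono_def)
  then show "(x, y) \<in> fd_rel X d" using R r(2) by (auto simp: fd_rel_def)
qed

text \<open>The equivalence properties are inherited from \<open>cauchy_rel\<close>, of which this
  relation is the restriction to FD-sequences.\<close>

lemma equiv_fd_rel: "equiv {x. fd_seq X d x} (fd_rel X d)"
proof (rule equivI)
  note E = equiv_cauchy_rel[unfolded equiv_def]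
  show "fd_rel X d \<subseteq> {x. fd_seq X d x} \<times> {x. fd_seq X d x}"
    by (auto simp: fd_rel_def)
  show "refl_on {x. fd_seq X d x} (fd_rel X d)"
    using E fd_seq_imp_cauchy_seq by (simp add: refl_on_def fd_rel_iff_cauchy_rel)
  show "sym (fd_rel X d)"
    using E by (intro symI) (auto simp: fd_rel_iff_cauchy_rel dest: symD)
  show "trans (fd_rel X d)"
    using E by (intro transI) (auto simp: fd_rel_iff_cauchy_rel dest: transD)
qed

section \<open>Limits of distances and the two distances on classes\<close>

text \<open>The limit may be \<infinity>, so differences of distances are avoided: the quadrilateral
  inequality is kept in additive form and gives upper limit at most lower limit plus any positive
  \<open>e\<close>.\<close>

lemma cauchy_seq_dist_convergent:
  assumes "cauchy_seq X d x" "cauchy_seq X d y"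
  obtains L where "(\<lambda>n. d (x n) (y n)) \<longlonglongrightarrow> L"
proof -
  let ?f = "\<lambda>n. d (x n) (y n)"
  note in_X = assms[THEN cauchy_seq_in]
  have eps: "limsup ?f \<le> liminf ?f + ennreal e" if "e > 0" for e :: real
  proof -
    have e: "0 < ennreal (e / 2)" using that by simp
    obtain N1 where N1: "\<And>m n. m \<ge> N1 \<Longrightarrow> n \<ge> N1 \<Longrightarrow> d (x m) (x n) < ennreal (e / 2)"
      using cauchy_seqD[OF assms(1) e] by blast
    obtain N2 where N2: "\<And>m n. m \<ge> N2 \<Longrightarrow> n \<ge> N2 \<Longrightarrow> d (y m) (y n) < ennreal (e / 2)"
      using cauchy_seqD[OF assms(2) e] by blast
    have le: "?f m \<le> ?f n + ennreal e" if "m \<ge> max N1 N2" "n \<ge> max N1 N2" for m n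
    proof -
      have "?f m \<le> d (x m) (x n) + d (x n) (y n) + d (y n) (y m)"
        by (intro triangle3 in_X)
      also have "\<dots> \<le> ennreal (e / 2) + d (x n) (y n) + ennreal (e / 2)"
        using that by (intro add_mono order_refl N1[THEN less_imp_le] N2[THEN less_imp_le]) auto
      also have "\<dots> = ?f n + (ennreal (e / 2) + ennreal (e / 2))"
        by (simp add: ac_simps)
      finally show ?thesis using \<open>e > 0\<close> by (simp flip: ennreal_plus)
    qed
    \<comment> \<open>In the preceding bound \<open>m\<close> tends to infinity first, with
      \<open>n\<close> fixed; then the lower limit is taken in \<open>n\<close>.\<close>
    have "limsup ?f \<le> ?f n + ennreal e" if "n \<ge> max N1 N2" for n
      using le that
      by (intro Limsup_bounded) (auto simp: eventually_sequentially intro!: exI[of _ "max N1 N2"])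
    then have "limsup ?f \<le> liminf (\<lambda>n. ?f n + ennreal e)"
      by (intro Liminf_bounded) (auto simp: eventually_sequentially intro!: exI[of _ "max N1 N2"])
    also have "\<dots> = liminf ?f + ennreal e"
      by (rule Liminf_add_const) simp_all
    finally show ?thesis .
  qed
  have "limsup ?f \<le> liminf ?f" by (rule ennreal_le_epsilon) (rule eps)
  then have "limsup ?f = liminf ?f"
    by (rule antisym) (simp add: Liminf_le_Limsup)
  then have "?f \<longlonglongrightarrow> liminf ?f"
    by (intro Liminf_eq_Limsup) simp_all
  then show ?thesis using that by blast
qed

text \<open>The distances of the primed sequences have some limit; letting \<open>n\<close> tend to
  infinity in the quadrilateral inequality, in both directions, identifies it with
  \<open>L\<close>.\<close>

lemma cauchy_rel_dist_tendsto:
  assumes "(x, x') \<in> cauchy_rel X d" "(y, y') \<in> cauchy_rel X d"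
    and L: "(\<lambda>n. d (x n) (y n)) \<longlonglongrightarrow> L"
  shows "(\<lambda>n. d (x' n) (y' n)) \<longlonglongrightarrow> L"
proof -
  have c: "cauchy_seq X d x" "cauchy_seq X d x'" "cauchy_seq X d y" "cauchy_seq X d y'"
    and l: "(\<lambda>n. d (x n) (x' n)) \<longlonglongrightarrow> 0" "(\<lambda>n. d (y n) (y' n)) \<longlonglongrightarrow> 0"
    using assms by (auto simp: cauchy_rel_def)
  note in_X = c[THEN cauchy_seq_in]
  obtain L' where L': "(\<lambda>n. d (x' n) (y' n)) \<longlonglongrightarrow> L'"
    using cauchy_seq_dist_convergent[OF c(2,4)] .
  have flip: "d (x' n) (x n) = d (x n) (x' n)" "d (y' n) (y n) = d (y n) (y' n)" for n
    by (intro sym_metric_on_sym[OF sm] in_X)+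
  have "d (x n) (y n) \<le> d (x n) (x' n) + d (x' n) (y' n) + d (y n) (y' n)" for n
    using triangle3[of "x n" "y n" "x' n" "y' n"] in_X by (simp add: flip)
  then have "L \<le> 0 + L' + 0"
    by (intro LIMSEQ_le[OF L tendsto_add[OF tendsto_add[OF l(1) L'] l(2)]]) blast
  moreover have "d (x' n) (y' n) \<le> d (x n) (x' n) + d (x n) (y n) + d (y n) (y' n)" for n
    using triangle3[of "x' n" "y' n" "x n" "y n"] in_X by (simp add: flip)
  then have "L' \<le> 0 + L + 0"
    by (intro LIMSEQ_le[OF L' tendsto_add[OF tendsto_add[OF l(1) L] l(2)]]) blast
  ultimately show ?thesis using L' by simp
qed

abbreviation "cauchy_class x \<equiv> cauchy_rel X d `` {x}"
abbreviation "fd_class x \<equiv> fd_rel X d `` {x}"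

lemma cauchy_class_self: "cauchy_seq X d x \<Longrightarrow> (x, x) \<in> cauchy_rel X d"
  using equiv_cauchy_rel by (simp add: equiv_def refl_on_def)

lemma fd_class_self: "fd_seq X d x \<Longrightarrow> (x, x) \<in> fd_rel X d"
  using equiv_fd_rel by (simp add: equiv_def refl_on_def)

lemma cauchy_completionE:
  assumes "\<xi> \<in> cauchy_completion X d"
  obtains x where "cauchy_seq X d x" "\<xi> = cauchy_class x"
  using assms unfolding cauchy_completion_def by (auto elim: quotientE)

lemma fd_completionE:
  assumes "\<xi> \<in> fd_completion X d"
  obtains x where "fd_seq X d x" "\<xi> = fd_class x"
  using assms unfolding fd_completion_def by (auto elim: quotientE)

lemma cauchy_class_in_completion: "cauchy_seq X d x \<Longrightarrow> cauchy_class x \<in> cauchy_completion X d"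
  unfolding cauchy_completion_def by (auto intro: quotientI)

lemma fd_class_in_completion: "fd_seq X d x \<Longrightarrow> fd_class x \<in> fd_completion X d"
  unfolding fd_completion_def by (auto intro: quotientI)

text \<open>This justifies the definite description in \<open>cauchy_dist\<close>: a limit exists,
  all representatives share it, and it is unique because the classes contain \<open>x\<close> and
  \<open>y\<close>.\<close>

lemma cauchy_dist_tendsto:
  assumes "cauchy_seq X d x" "cauchy_seq X d y"
  shows "(\<lambda>n. d (x n) (y n)) \<longlonglongrightarrow> cauchy_dist d (cauchy_class x) (cauchy_class y)"
proof -
  obtain L where L: "(\<lambda>n. d (x n) (y n)) \<longlonglongrightarrow> L"
    using cauchy_seq_dist_convergent[OF assms] .
  have "cauchy_dist d (cauchy_class x) (cauchy_class y) = L"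
    unfolding cauchy_dist_def
    using cauchy_rel_dist_tendsto[OF _ _ L] cauchy_class_self assms
    by (intro the_equality) (auto intro: LIMSEQ_unique[OF _ L])
  then show ?thesis using L by simp
qed

text \<open>Every pair of representatives has the same lower limit, so the infimum runs over a
  single value.\<close>

lemma fd_dist_class:
  assumes "fd_seq X d x" "fd_seq X d y"
  shows "fd_dist d (fd_class x) (fd_class y) = cauchy_dist d (cauchy_class x) (cauchy_class y)"
    (is "_ = ?L")
proof -
  have L: "(\<lambda>n. d (x n) (y n)) \<longlonglongrightarrow> ?L"
    using assms by (intro cauchy_dist_tendsto fd_seq_imp_cauchy_seq)
  have "liminf (\<lambda>k. d (x' k) (y' k)) = ?L" if "x' \<in> fd_class x" "y' \<in> fd_class y" for x' y'
    using that by (intro lim_imp_Liminf cauchy_rel_dist_tendsto[OF _ _ L])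
      (auto simp: fd_rel_iff_cauchy_rel)
  then have "fd_dist d (fd_class x) (fd_class y) = (INF x\<in>fd_class x. INF y\<in>fd_class y. ?L)"
    unfolding fd_dist_def by simp
  \<comment> \<open>The classes have to be nonempty here, since an infimum over the empty set would
    be \<infinity>.\<close>
  also have "\<dots> = ?L"
    using fd_class_self assms by (subst INF_const; (subst INF_const)?) auto
  finally show ?thesis .
qed

text \<open>Each axiom passes to the limit along representatives, and distance 0 says that the
  representatives are equivalent. The uniqueness argument uses this for open balls and the triangle
  inequality.\<close>

lemma sym_metric_on_cauchy_completion: "sym_metric_on (cauchy_completion X d) (cauchy_dist d)"
proof -
  note dist = cauchy_dist_tendsto
  have "cauchy_dist d \<xi> \<xi> = 0" if \<xi>: "\<xi> \<in> cauchy_completion X d" for \<xi>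
  proof -
    obtain x where x: "cauchy_seq X d x" "\<xi> = cauchy_class x" using cauchy_completionE[OF \<xi>] .
    then show ?thesis
      using dist[of x x] sym_metric_on_refl[OF sm] cauchy_seq_in by (simp add: LIMSEQ_const_iff)
  qed
  moreover have "cauchy_dist d \<xi> \<eta> = cauchy_dist d \<eta> \<xi>" "cauchy_dist d \<xi> \<eta> = 0 \<Longrightarrow> \<xi> = \<eta>"
    if \<xi>: "\<xi> \<in> cauchy_completion X d" and \<eta>: "\<eta> \<in> cauchy_completion X d" for \<xi> \<eta>
  proof -
    obtain x where x: "cauchy_seq X d x" "\<xi> = cauchy_class x" using cauchy_completionE[OF \<xi>] .
    obtain y where y: "cauchy_seq X d y" "\<eta> = cauchy_class y" using cauchy_completionE[OF \<eta>] .
    have "(\<lambda>n. d (x n) (y n)) = (\<lambda>n. d (y n) (x n))"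
      using sym_metric_on_sym[OF sm] cauchy_seq_in x y by blast
    then show "cauchy_dist d \<xi> \<eta> = cauchy_dist d \<eta> \<xi>"
      using dist[OF x(1) y(1)] dist[OF y(1) x(1)] x y by (auto intro: LIMSEQ_unique)
    assume "cauchy_dist d \<xi> \<eta> = 0"
    then have "(x, y) \<in> cauchy_rel X d"
      using dist[OF x(1) y(1)] x y by (simp add: cauchy_rel_def)
    then show "\<xi> = \<eta>" using x y equiv_class_eq[OF equiv_cauchy_rel] by blast
  qed
  moreover have "cauchy_dist d \<xi> \<zeta> \<le> cauchy_dist d \<xi> \<eta> + cauchy_dist d \<eta> \<zeta>"
    if \<xi>: "\<xi> \<in> cauchy_completion X d" and \<eta>: "\<eta> \<in> cauchy_completion X d"
      and \<zeta>: "\<zeta> \<in> cauchy_completion X d" for \<xi> \<eta> \<zeta>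
  proof -
    obtain x where x: "cauchy_seq X d x" "\<xi> = cauchy_class x" using cauchy_completionE[OF \<xi>] .
    obtain y where y: "cauchy_seq X d y" "\<eta> = cauchy_class y" using cauchy_completionE[OF \<eta>] .
    obtain z where z: "cauchy_seq X d z" "\<zeta> = cauchy_class z" using cauchy_completionE[OF \<zeta>] .
    show ?thesis
      unfolding x(2) y(2) z(2)
      by (rule LIMSEQ_le[OF dist tendsto_add[OF dist dist]])
        (auto intro!: sym_metric_on_triangle[OF sm] x y z cauchy_seq_in)
  qed
  ultimately show ?thesis
    unfolding sym_metric_on_def asym_metric_on_def by (intro conjI ballI impI) blast+
qed

section \<open>The isometric bijection between the completions\<close>

lemma fd_seq_const: "a \<in> X \<Longrightarrow> fd_seq X d (\<lambda>_. a)"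
  by (auto simp: fd_seq_def sym_metric_on_refl[OF sm])

text \<open>An FD-class contains its representative and lies in one Cauchy class, so its relational
  image is that class. The extension can thus be written without choosing representatives.\<close>

lemma cauchy_image_fd_class:
  assumes "fd_seq X d x"
  shows "cauchy_rel X d `` fd_class x = cauchy_class x"
  using fd_class_self[OF assms] equiv_cauchy_rel
  by (auto simp: fd_rel_iff_cauchy_rel equiv_def dest: transD)

text \<open>Injectivity holds because Cauchy-equivalent FD-sequences are FD-equivalent, surjectivity
  because every Cauchy class contains an FD-sequence.\<close>

lemma bij_betw_cauchy_image:
  "bij_betw (\<lambda>\<xi>. cauchy_rel X d `` \<xi>) (fd_completion X d) (cauchy_completion X d)"
proof (rule bij_betw_imageI[OF inj_onI subset_antisym[OF subsetI subsetI]])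
  fix \<xi> \<eta> assume \<xi>: "\<xi> \<in> fd_completion X d" and \<eta>: "\<eta> \<in> fd_completion X d"
    and eq: "cauchy_rel X d `` \<xi> = cauchy_rel X d `` \<eta>"
  obtain x where x: "fd_seq X d x" "\<xi> = fd_class x" using fd_completionE[OF \<xi>] .
  obtain y where y: "fd_seq X d y" "\<eta> = fd_class y" using fd_completionE[OF \<eta>] .
  have "(x, y) \<in> cauchy_rel X d"
    using eq cauchy_class_self[OF fd_seq_imp_cauchy_seq[OF y(1)]]
    by (auto simp: x y cauchy_image_fd_class)
  then have "(x, y) \<in> fd_rel X d" using x y by (simp add: fd_rel_iff_cauchy_rel)
  then show "\<xi> = \<eta>" using x y equiv_class_eq[OF equiv_fd_rel] by blast
next
  fix \<xi> assume "\<xi> \<in> (\<lambda>\<xi>. cauchy_rel X d `` \<xi>) ` fd_completion X d"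
  then obtain \<eta> where \<eta>: "\<eta> \<in> fd_completion X d" "\<xi> = cauchy_rel X d `` \<eta>" by blast
  obtain x where "fd_seq X d x" "\<eta> = fd_class x" using fd_completionE[OF \<eta>(1)] .
  then show "\<xi> \<in> cauchy_completion X d"
    using \<eta>(2) by (simp add: cauchy_image_fd_class cauchy_class_in_completion fd_seq_imp_cauchy_seq)
next
  fix \<xi> assume "\<xi> \<in> cauchy_completion X d"
  then obtain x where x: "cauchy_seq X d x" "\<xi> = cauchy_class x" by (rule cauchy_completionE)
  obtain y where y: "fd_seq X d y" "(x, y) \<in> cauchy_rel X d" using cauchy_rel_fd_seq[OF x(1)] .
  then have "\<xi> = cauchy_rel X d `` fd_class y"
    using x equiv_class_eq[OF equiv_cauchy_rel] by (simp add: cauchy_image_fd_class)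
  then show "\<xi> \<in> (\<lambda>\<xi>. cauchy_rel X d `` \<xi>) ` fd_completion X d"
    using fd_class_in_completion[OF y(1)] by blast
qed

lemma cauchy_image_isometry:
  assumes "\<xi> \<in> fd_completion X d" "\<eta> \<in> fd_completion X d"
  shows "cauchy_dist d (cauchy_rel X d `` \<xi>) (cauchy_rel X d `` \<eta>) = fd_dist d \<xi> \<eta>"
proof -
  obtain x where "fd_seq X d x" "\<xi> = fd_class x" using fd_completionE[OF assms(1)] .
  moreover obtain y where "fd_seq X d y" "\<eta> = fd_class y" using fd_completionE[OF assms(2)] .
  ultimately show ?thesis by (simp add: cauchy_image_fd_class fd_dist_class)
qed

lemma cauchy_image_embed:
  "a \<in> X \<Longrightarrow> cauchy_rel X d `` fd_embed X d a = cauchy_embed X d a"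
  unfolding fd_embed_def cauchy_embed_def by (intro cauchy_image_fd_class fd_seq_const)

section \<open>Density of the constant sequences and uniqueness of the extension\<close>

text \<open>A late term of a representing sequence, taken as a constant sequence, approximates the
  class.\<close>

lemma fd_embed_dense:
  assumes "\<xi> \<in> fd_completion X d" "e > 0"
  obtains a where "a \<in> X" "fd_dist d \<xi> (fd_embed X d a) < e"
proof -
  obtain x where x: "fd_seq X d x" "\<xi> = fd_class x" using fd_completionE[OF assms(1)] .
  note c = fd_seq_imp_cauchy_seq[OF x(1)]
  \<comment> \<open>A limit preserves only weak inequalities, so a bound \<open>u\<close> strictly
    below \<open>e\<close> is used.\<close>
  obtain u where u: "0 < u" "u < e" using dense[OF assms(2)] by blast
  obtain N where N: "\<And>m n. m \<ge> N \<Longrightarrow> n \<ge> N \<Longrightarrow> d (x m) (x n) < u"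
    using cauchy_seqD[OF c u(1)] by blast
  have xN: "x N \<in> X" using x by (simp add: fd_seq_in)
  have "cauchy_dist d (cauchy_class x) (cauchy_class (\<lambda>_. x N)) \<le> u"
    using N less_imp_le
    by (intro LIMSEQ_le_const2[OF cauchy_dist_tendsto[OF c fd_seq_imp_cauchy_seq]] fd_seq_const xN) blast
  then have "fd_dist d \<xi> (fd_embed X d (x N)) < e"
    using u x xN by (simp add: fd_embed_def fd_dist_class fd_seq_const)
  then show ?thesis using that xN by blast
qed

text \<open>Near \<open>\<xi>\<close> there is a class of a constant sequence, on which
  \<open>g\<close> and the canonical map agree. Continuity of \<open>g\<close> and the isometry put
  their common value close to both \<open>g \<xi>\<close> and the canonical image.\<close>

lemma continuous_id_extension_unique:
  assumes g: "continuous_id_extension X d g" and \<xi>: "\<xi> \<in> fd_completion X d"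
  shows "g \<xi> = cauchy_rel X d `` \<xi>"
proof -
  let ?C = "cauchy_completion X d" and ?f = "\<lambda>\<xi>. cauchy_rel X d `` \<xi>"
  note C = sym_metric_on_cauchy_completion
  have cont: "continuous_map (fd_topology X d) (cauchy_topology X d) g"
    and ext: "\<And>a. a \<in> X \<Longrightarrow> g (fd_embed X d a) = cauchy_embed X d a"
    using g by (auto simp: continuous_id_extension_def)
  have g\<xi>: "g \<xi> \<in> ?C" using cont \<xi> by (auto simp: continuous_map_def)
  have f\<xi>: "?f \<xi> \<in> ?C" using bij_betw_cauchy_image \<xi> by (auto simp: bij_betw_def)
  have "cauchy_dist d (g \<xi>) (?f \<xi>) < e" if e: "e > 0" for e
  proof -
    obtain h where h: "h > 0" "\<And>a b c. a < h \<Longrightarrow> b < h \<Longrightarrow> c < h \<Longrightarrow> a + b + c < e"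
      using ennreal_third[OF e] by metis
    have "openin (fd_topology X d)
            {\<eta> \<in> fd_completion X d. g \<eta> \<in> {\<zeta> \<in> ?C. cauchy_dist d (g \<xi>) \<zeta> < h}}"
      using openin_continuous_map_preimage[OF cont openin_dist_ball[OF C g\<xi>]] by simp
    moreover have "cauchy_dist d (g \<xi>) (g \<xi>) < h"
      using sym_metric_on_refl[OF C g\<xi>] h(1) by simp
    ultimately obtain s where s: "s > 0"
      "\<And>\<eta>. \<eta> \<in> fd_completion X d \<Longrightarrow> fd_dist d \<xi> \<eta> < s \<Longrightarrow> cauchy_dist d (g \<xi>) (g \<eta>) < h"
      using \<xi> g\<xi> unfolding openin_dist_topology by blast
    \<comment> \<open>Radius \<open>s\<close> serves the continuity of \<open>g\<close>, radius
      \<open>h\<close> the isometry.\<close>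
    obtain a where a: "a \<in> X" "fd_dist d \<xi> (fd_embed X d a) < min s h"
      using fd_embed_dense[OF \<xi>, of "min s h"] s(1) h(1) by auto
    have emb: "fd_embed X d a \<in> fd_completion X d"
      unfolding fd_embed_def by (intro fd_class_in_completion fd_seq_const a)
    have b: "cauchy_embed X d a \<in> ?C"
      unfolding cauchy_embed_def
      by (intro cauchy_class_in_completion fd_seq_imp_cauchy_seq fd_seq_const a)
    have 1: "cauchy_dist d (g \<xi>) (cauchy_embed X d a) < h"
      using s(2)[OF emb] a ext by simp
    have 2: "cauchy_dist d (cauchy_embed X d a) (?f \<xi>) < h"
      using cauchy_image_isometry[OF \<xi> emb] a sym_metric_on_sym[OF C b f\<xi>]
      by (simp add: cauchy_image_embed)
    have "cauchy_dist d (g \<xi>) (?f \<xi>)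
        \<le> cauchy_dist d (g \<xi>) (cauchy_embed X d a) + cauchy_dist d (cauchy_embed X d a) (?f \<xi>)"
      by (intro sym_metric_on_triangle[OF C] g\<xi> f\<xi> b)
    also have "\<dots> < e" using h(2)[OF 1 2 h(1)] by simp
    finally show ?thesis .
  qed
  \<comment> \<open>A positive distance could itself be taken as \<open>e\<close>, making it smaller
    than itself.\<close>
  then have "cauchy_dist d (g \<xi>) (?f \<xi>) = 0"
    by (metis less_irrefl zero_less_iff_neq_zero)
  then show ?thesis using sym_metric_on_eq[OF C g\<xi> f\<xi>] by blast
qed

end

text \<open>Functions in HOL are total, so uniqueness means agreement on
  \<open>fd_completion X d\<close>. The witness takes the Cauchy class containing a given FD-class;
  its continuity is read off from the homeomorphism.\<close>

theorem theoremB12: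
  fixes X :: "'a set" and d :: "'a \<Rightarrow> 'a \<Rightarrow> ennreal"
  assumes "sym_metric_on X d"
  shows "\<exists>f. continuous_id_extension X d f \<and>
           (\<forall>g. continuous_id_extension X d g \<longrightarrow> (\<forall>\<xi>\<in>fd_completion X d. g \<xi> = f \<xi>)) \<and>
           (\<forall>\<xi>\<in>fd_completion X d. \<forall>\<eta>\<in>fd_completion X d.
              cauchy_dist d (f \<xi>) (f \<eta>) = fd_dist d \<xi> \<eta>) \<and>
           homeomorphic_map (fd_topology X d) (cauchy_topology X d) f"
proof -
  let ?f = "\<lambda>\<xi>. cauchy_rel X d `` \<xi>"
  have iso: "cauchy_dist d (?f \<xi>) (?f \<eta>) = fd_dist d \<xi> \<eta>"
    if "\<xi> \<in> fd_completion X d" "\<eta> \<in> fd_completion X d" for \<xi> \<eta>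
    using cauchy_image_isometry[OF assms that] .
  have homeo: "homeomorphic_map (fd_topology X d) (cauchy_topology X d) ?f"
    by (intro homeomorphic_map_isometry bij_betw_cauchy_image assms iso)
  moreover have "continuous_id_extension X d ?f"
    using homeomorphic_imp_continuous_map[OF homeo] cauchy_image_embed[OF assms]
    by (simp add: continuous_id_extension_def)
  ultimately show ?thesis
    using iso continuous_id_extension_unique[OF assms] by (intro exI[of _ ?f] conjI allI impI ballI)
qed

end
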